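(* Let $p,n\in\mathbb N$ with $p\ge n-1\ge 4$, and write $p=k(n-1)+r$ with $k\in\mathbb N$ and $r\in\{0,1,\ldots,n-2\}$. Then $$ex(p;T_n^2)=\max\Big\{\Big[\tfrac{(n-2)p}{2}\Big]-(n-1+r),\ \tfrac{(n-2)p-r(n-1-r)}{2}\Big\},$$ and explicitly $$ex(p;T_n^2)=\begin{cases}\big[\tfrac{(n-2)p}{2}\big]-(n-1+r) & \text{if } n\ge 16 \text{ and } 3\le r\le n-6, \text{ or if } 13\le n\le 15 \text{ and } 4\le r\le n-7,\\[2pt] \tfrac{(n-2)p-r(n-1-r)}{2} & \text{otherwise.}\end{cases}$$
   Context: All graphs are finite and simple; a graph "contains" $H$ if it has a subgraph isomorphic to $H$. $\mathbb N=\{1,2,3,\ldots\}$ and $[x]$ denotes the greatest integer not exceeding $x$. For a graph $L$ and $p\in\mathbb N$, $ex(p;L)$ is the maximum number of edges in a graph on $p$ vertices that contains no copy of $L$. For $n\ge 5$, $T_n^2$ is the tree with vertex set $\{v_0,v_1,\ldots,v_{n-1}\}$ and edge set $\{v_0v_1,v_0v_2,\ldots,v_0v_{n-3},\,v_{n-3}v_{n-2},\,v_{n-3}v_{n-1}\}$. *)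

theory Defs
  imports Complex_Main
begin

definition simple_graph :: "'a set \<Rightarrow> 'a set set \<Rightarrow> bool" where
  "simple_graph V E \<longleftrightarrow> finite V \<and>
     (\<forall>e\<in>E. \<exists>u v. u \<noteq> v \<and> u \<in> V \<and> v \<in> V \<and> e = {u, v})"

definition contains :: "'a set \<times> 'a set set \<Rightarrow> 'b set \<times> 'b set set \<Rightarrow> bool" where
  "contains G H \<longleftrightarrow> (\<exists>f. inj_on f (fst H) \<and> f ` fst H \<subseteq> fst G \<and>
     (\<forall>u v. {u, v} \<in> snd H \<longrightarrow> {f u, f v} \<in> snd G))"

definition ex :: "nat \<Rightarrow> 'b set \<times> 'b set set \<Rightarrow> nat" where
  "ex p L = Max {card E | E. simple_graph {0..<p} E \<and> \<not> contains ({0..<p}, E) L}"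

definition T2 :: "nat \<Rightarrow> nat set \<times> nat set set" where
  "T2 n = ({0..<n},
     {{0, i} | i. 1 \<le> i \<and> i \<le> n - 3} \<union> {{n - 3, n - 2}, {n - 3, n - 1}})"

end

theory Submission
  imports Defs
begin

text \<open>Write \<open>N = n - 1\<close>. For the upper bound, call a set \<open>S\<close> of \<open>N\<close> vertices light if at most
  \<open>N (N - 1) / 2\<close> edges meet it: deleting \<open>S\<close> costs no more than deleting a component \<open>K\<^sub>N\<close>
  and preserves \<open>r\<close>, so induction applies. If the maximum degree is at most \<open>n - 4\<close>, the bound
  is the sum of degrees. Otherwise a light set exists around a vertex \<open>u\<close> of degree at least
  \<open>n - 3\<close>: twice the number of edges meeting \<open>S\<close> is the sum over \<open>v \<in> S\<close> of the degree of
  \<open>v\<close> plus the number of its neighbours outside \<open>S\<close>, and avoiding the tree forces the neighbours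
  of \<open>u\<close> to have few neighbours outside \<open>N[u]\<close> or small degree. One takes \<open>S\<close> inside
  \<open>N(u)\<close>, equal to \<open>N[u]\<close>, or \<open>N[u]\<close> plus one vertex, according to the degree of \<open>u\<close>.

  The lower bounds come from copies of \<open>K\<^sub>N\<close> together with either \<open>K\<^sub>r\<close> or a graph
  on \<open>N + r\<close> vertices that is as close to \<open>(n - 4)\<close>-regular as parity allows.\<close>

section \<open>Edges meeting a vertex set\<close>

definition nbrs :: "'a set set \<Rightarrow> 'a \<Rightarrow> 'a set" where
  "nbrs E v = {w. {v, w} \<in> E}"

definition incident :: "'a set set \<Rightarrow> 'a set \<Rightarrow> 'a set set" where
  "incident E S = {e \<in> E. e \<inter> S \<noteq> {}}"

lemma in_nbrs [simp]: "w \<in> nbrs E v \<longleftrightarrow> {v, w} \<in> E"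
  by (simp add: nbrs_def)

lemma simple_graph_edgeD:
  assumes "simple_graph V E" "e \<in> E"
  shows "card e = 2" "e \<subseteq> V"
  using assms unfolding simple_graph_def by force+

lemma simple_graph_finite:
  assumes "simple_graph V E"
  shows "finite V" "finite E"
proof -
  show "finite V" using assms by (simp add: simple_graph_def)
  moreover have "E \<subseteq> Pow V" using simple_graph_edgeD(2)[OF assms] by auto
  ultimately show "finite E" by (meson finite_Pow_iff finite_subset)
qed

lemma simple_graphI:
  assumes "finite V" "\<And>e. e \<in> E \<Longrightarrow> card e = 2 \<and> e \<subseteq> V"
  shows "simple_graph V E"
  unfolding simple_graph_def
proof (intro conjI ballI)
  fix e assume "e \<in> E"
  then have "card e = 2" "e \<subseteq> V" using assms(2) by auto
  then show "\<exists>u v. u \<noteq> v \<and> u \<in> V \<and> v \<in> V \<and> e = {u, v}"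
    by (auto simp: card_2_iff)
qed (fact assms(1))

lemma edge_neq: "simple_graph V E \<Longrightarrow> {u, v} \<in> E \<Longrightarrow> u \<noteq> v"
  using simple_graph_edgeD(1)[of V E "{u, v}"] by auto

lemma no_loop [simp]: "simple_graph V E \<Longrightarrow> {u} \<notin> E"
  using edge_neq[of V E u u] by auto

lemma nbrs_subset: "simple_graph V E \<Longrightarrow> nbrs E v \<subseteq> V - {v}"
  using simple_graph_edgeD(2)[of V E] edge_neq[of V E v] by (fastforce simp: nbrs_def)

lemma finite_nbrs: "simple_graph V E \<Longrightarrow> finite (nbrs E v)"
  by (meson finite_Diff finite_subset nbrs_subset simple_graph_finite(1))

text \<open>Counting ordered pairs lets edges be summed vertex by vertex; each two-element edge has
  exactly two orientations.\<close>

lemma card_orientations: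
  assumes "finite F" "\<And>e. e \<in> F \<Longrightarrow> card e = 2"
  shows "card {(v, w). {v, w} \<in> F} = 2 * card F"
proof -
  let ?P = "\<lambda>e. {(v, w). {v, w} = e}"
  have P: "finite (?P e) \<and> card (?P e) = 2" if e: "e \<in> F" for e
  proof -
    obtain a b where "a \<noteq> b" "e = {a, b}" using assms(2)[OF e] by (auto simp: card_2_iff)
    then have "?P e = {(a, b), (b, a)}" by (auto simp: doubleton_eq_iff)
    then show ?thesis using \<open>a \<noteq> b\<close> by simp
  qed
  have "{(v, w). {v, w} \<in> F} = (\<Union>e\<in>F. ?P e)" by auto
  then have "card {(v, w). {v, w} \<in> F} = (\<Sum>e\<in>F. card (?P e))"
    using P assms(1) by (simp only:) (rule card_UN_disjoint, auto)
  also have "\<dots> = 2 * card F" using P by simp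
  finally show ?thesis .
qed

text \<open>Orient every edge that meets \<open>S\<close> both ways. The pairs starting in
  \<open>S\<close> give the degrees; the pairs that start outside and end in \<open>S\<close> are
  the swaps of pairs leaving \<open>S\<close>, which gives the second summand.\<close>

lemma twice_card_incident:
  assumes G: "simple_graph V E" and S: "S \<subseteq> V"
  shows "2 * card (incident E S) = (\<Sum>v\<in>S. card (nbrs E v) + card (nbrs E v - S))"
proof -
  have fS: "finite S" using S simple_graph_finite(1)[OF G] finite_subset by blast
  have fn: "finite (nbrs E v)" for v using finite_nbrs[OF G] .
  let ?A = "Sigma S (nbrs E)" and ?B = "Sigma S (\<lambda>v. nbrs E v - S)"
  have "{(v, w). {v, w} \<in> incident E S} = ?A \<union> prod.swap ` ?B"
    by (auto simp: incident_def insert_commute image_iff)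
  moreover have "?A \<inter> prod.swap ` ?B = {}" by auto
  ultimately have "card {(v, w). {v, w} \<in> incident E S} = card ?A + card (prod.swap ` ?B)"
    using fS fn by (simp add: card_Un_disjoint)
  also have "card (prod.swap ` ?B) = card ?B"
    by (rule card_image) (auto simp: inj_on_def)
  finally have "card {(v, w). {v, w} \<in> incident E S} = card ?A + card ?B" .
  moreover have "card {(v, w). {v, w} \<in> incident E S} = 2 * card (incident E S)"
    by (rule card_orientations)
      (use simple_graph_finite(2)[OF G] simple_graph_edgeD(1)[OF G] in \<open>auto simp: incident_def\<close>)
  ultimately show ?thesis using fS fn by (simp add: sum.distrib)
qed

lemma twice_card_incident_le:
  assumes G: "simple_graph V E" and S: "S \<subseteq> V"
    and "\<And>v. v \<in> S \<Longrightarrow> card (nbrs E v) + card (nbrs E v - S) \<le> c"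
  shows "2 * card (incident E S) \<le> card S * c"
  using sum_mono[OF assms(3), of S] unfolding twice_card_incident[OF G S] by simp

lemma handshake:
  assumes G: "simple_graph V E"
  shows "2 * card E = (\<Sum>v\<in>V. card (nbrs E v))"
proof -
  have "incident E V = E"
    using simple_graph_edgeD[OF G] by (fastforce simp: incident_def card_2_iff)
  moreover have "card (nbrs E v - V) = 0" for v
    using nbrs_subset[OF G] by (metis Diff_eq_empty_iff card.empty Diff_subset subset_trans)
  ultimately show ?thesis using twice_card_incident[OF G order_refl] by simp
qed

text \<open>The only edges gained by adding \<open>w\<close> join it to a vertex outside
  \<open>S\<close>. This prices the extra vertex added to a closed neighbourhood that is one vertex
  too small.\<close>

lemma card_incident_insert_le:
  assumes G: "simple_graph V E"
  shows "card (incident E (insert w S)) \<le> card (incident E S) + card (nbrs E w - S)"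
proof -
  have "incident E (insert w S) \<subseteq> incident E S \<union> (\<lambda>x. {w, x}) ` (nbrs E w - S)"
  proof
    fix e assume e: "e \<in> incident E (insert w S)"
    show "e \<in> incident E S \<union> (\<lambda>x. {w, x}) ` (nbrs E w - S)"
    proof (cases "e \<inter> S = {}")
      case True
      then have "w \<in> e" "e \<in> E" using e by (auto simp: incident_def)
      then obtain x where "e = {w, x}"
        using simple_graph_edgeD(1)[OF G] by (auto simp: card_2_iff)
      then show ?thesis using True \<open>e \<in> E\<close> by auto
    qed (use e in \<open>auto simp: incident_def\<close>)
  qed
  then have "card (incident E (insert w S))
      \<le> card (incident E S \<union> (\<lambda>x. {w, x}) ` (nbrs E w - S))"
    using simple_graph_finite(2)[OF G] finite_nbrs[OF G]
    by (intro card_mono) (auto simp: incident_def)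
  also have "\<dots> \<le> card (incident E S) + card ((\<lambda>x. {w, x}) ` (nbrs E w - S))"
    by (rule card_Un_le)
  also have "\<dots> \<le> card (incident E S) + card (nbrs E w - S)"
    using card_image_le[of "nbrs E w - S"] finite_nbrs[OF G] by simp
  finally show ?thesis .
qed

section \<open>Embedding the tree around an edge\<close>

lemma card_ge_1E:
  assumes "1 \<le> card A"
  obtains a where "a \<in> A"
  using assms by (cases "A = {}") auto

lemma card_ge_2E:
  assumes "2 \<le> card A"
  obtains a b where "a \<noteq> b" "{a, b} \<subseteq> A"
proof -
  obtain B where "B \<subseteq> A" "card B = 2" using obtain_subset_with_card_n[OF assms] by metis
  then show thesis using that by (auto simp: card_2_iff)
qed

text \<open>The vertex \<open>u\<close> plays the centre \<open>0\<close>, \<open>v\<close> plays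
  \<open>n - 3\<close>, and \<open>a\<close>, \<open>b\<close> play the two leaves behind it. The
  other \<open>n - 4\<close> leaves are then placed injectively among the remaining neighbours of
  \<open>u\<close>; it does not matter whether \<open>a\<close> and \<open>b\<close> are adjacent to
  \<open>u\<close>.\<close>

lemma contains_T2I:
  assumes G: "simple_graph V E" and n: "n \<ge> 5" and uv: "{u, v} \<in> E"
    and a: "{v, a} \<in> E" "a \<noteq> u" and b: "{v, b} \<in> E" "b \<noteq> u" and "a \<noteq> b"
    and c: "n - 4 \<le> card (nbrs E u - {v, a, b})"
  shows "contains (V, E) (T2 n)"
proof -
  let ?X = "nbrs E u - {v, a, b}"
  have "card {1..n - 4} \<le> card ?X" using c by simp
  then obtain g where g: "g ` {1..n - 4} \<subseteq> ?X" "inj_on g {1..n - 4}"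
    using card_le_inj[of "{1..n - 4}" ?X] finite_nbrs[OF G] by auto
  define f where "f i = (if i = 0 then u else if i = n - 3 then v
    else if i = n - 2 then a else if i = n - 1 then b else g i)" for i
  have f: "f 0 = u" "f (n - 3) = v" "f (n - 2) = a" "f (n - 1) = b"
    "\<And>i. i \<in> {1..n - 4} \<Longrightarrow> f i = g i"
    using n by (auto simp: f_def)
  have verts: "{0..<n} = {0, n - 3, n - 2, n - 1} \<union> {1..n - 4}"
    using n by auto
  have inV: "x \<in> V \<and> y \<in> V \<and> x \<noteq> y" if "{x, y} \<in> E" for x y
    using simple_graph_edgeD(2)[OF G that] edge_neq[OF G that] by auto
  have gX: "g i \<in> ?X" if "i \<in> {1..n - 4}" for i using g(1) that by blast
  have fg: "f ` {1..n - 4} = g ` {1..n - 4}" using f(5) by auto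
  have "inj_on f {1..n - 4}" using g(2) f(5) by (simp add: inj_on_def)
  moreover have "inj_on f {0, n - 3, n - 2, n - 1}"
    using f(1-4) inV[OF uv] inV[OF a(1)] inV[OF b(1)] a b \<open>a \<noteq> b\<close> by (auto simp: inj_on_def)
  moreover have "f ` {0, n - 3, n - 2, n - 1} \<inter> f ` {1..n - 4} = {}"
    unfolding fg using f(1-4) gX no_loop[OF G] by fastforce
  ultimately have "inj_on f {0..<n}"
    unfolding verts by (intro inj_on_Un[THEN iffD2]) auto
  moreover have "f ` {0..<n} \<subseteq> V"
  proof -
    have "g i \<in> V" if "i \<in> {1..n - 4}" for i using gX[OF that] inV by fastforce
    then show ?thesis
      unfolding verts image_Un fg using f(1-4) inV[OF uv] inV[OF a(1)] inV[OF b(1)] by auto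
  qed
  moreover have fE: "{f i, f j} \<in> E" if ij: "{i, j} \<in> snd (T2 n)" for i j
  proof -
    \<comment> \<open>A tree edge is unordered, so the cases supply only some ordering of its ends;
      symmetry of \<open>{f i, f j}\<close> then covers the given one.\<close>
    have edge: "\<exists>i j. e = {i, j} \<and> {f i, f j} \<in> E" if e: "e \<in> snd (T2 n)" for e
    proof -
      consider i where "e = {0, i}" "i \<in> {1..n - 4}" | "e = {0, n - 3}"
        | "e = {n - 3, n - 2}" | "e = {n - 3, n - 1}"
      proof -
        have "\<exists>i. e = {0, i} \<and> 1 \<le> i \<and> i \<le> n - 3 \<or> e = {n - 3, n - 2} \<or> e = {n - 3, n - 1}"
          using e by (auto simp: T2_def)
        moreover have "i \<in> {1..n - 4} \<or> i = n - 3" if "1 \<le> i" "i \<le> n - 3" for i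
          using that n by auto
        ultimately show ?thesis using that by metis
      qed
      then show ?thesis
      proof cases
        case 1
        then have "{f 0, f i} \<in> E" using gX f(1,5) by auto
        then show ?thesis using 1 by blast
      qed (use f uv a b in metis)+
    qed
    obtain k l where "{i, j} = {k, l}" "{f k, f l} \<in> E" using edge[OF ij] by blast
    then show ?thesis by (auto simp: doubleton_eq_iff insert_commute)
  qed
  moreover have "fst (T2 n) = {0..<n}" by (simp add: T2_def)
  ultimately show ?thesis unfolding contains_def by (intro exI[of _ f]) simp
qed

section \<open>The upper bound\<close>

definition light :: "'a set \<Rightarrow> 'a set set \<Rightarrow> nat \<Rightarrow> 'a set \<Rightarrow> bool" where
  "light V E n S \<longleftrightarrow> S \<subseteq> V \<and> card S = n - 1 \<and> 2 * card (incident E S) \<le> (n - 1) * (n - 2)"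

context
  fixes V :: "'a set" and E :: "'a set set" and n :: nat
  assumes G: "simple_graph V E" and n: "n \<ge> 5" and free: "\<not> contains (V, E) (T2 n)"
begin

section \<open>Local structure near a vertex of large degree\<close>

lemma free_card_less:
  assumes "{u, v} \<in> E" "{v, a} \<in> E" "a \<noteq> u" "{v, b} \<in> E" "b \<noteq> u" "a \<noteq> b"
  shows "card (nbrs E u - {v, a, b}) < n - 4"
  using contains_T2I[OF G n assms(1-6)] free by fastforce

text \<open>This lemma and the next two are one argument: each of \<open>v\<close>,
  \<open>a\<close>, \<open>b\<close> that lies in the neighbourhood of \<open>u\<close> takes away
  one candidate leaf, and \<open>n - 4\<close> must remain. Here all three may lie there, so degree
  \<open>n - 1\<close> is required; with one of \<open>a\<close>, \<open>b\<close> outside, degree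
  \<open>n - 2\<close> suffices, and with both outside, \<open>n - 3\<close>.\<close>

lemma nbr_degree_le_2:
  assumes "n - 1 \<le> card (nbrs E u)" "{u, v} \<in> E"
  shows "card (nbrs E v) \<le> 2"
proof (rule ccontr)
  assume "\<not> card (nbrs E v) \<le> 2"
  then have "2 \<le> card (nbrs E v - {u})" using finite_nbrs[OF G] assms(2)
    by (simp add: insert_commute)
  then obtain a b where ab: "a \<noteq> b" "{a, b} \<subseteq> nbrs E v - {u}"
    by (rule card_ge_2E)
  have "card (nbrs E u) - card {v, a, b} \<le> card (nbrs E u - {v, a, b})"
    by (intro diff_card_le_card_Diff) auto
  moreover have "card {v, a, b} \<le> 3" by (simp add: card_insert_if)
  moreover have "card (nbrs E u - {v, a, b}) < n - 4"
    by (rule free_card_less) (use ab assms in auto)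
  ultimately show False using assms(1) by linarith
qed

lemma outside_nbr_degree_le_2:
  assumes "n - 2 \<le> card (nbrs E u)" "{u, v} \<in> E" "{v, a} \<in> E" "a \<notin> insert u (nbrs E u)"
  shows "card (nbrs E v) \<le> 2"
proof (rule ccontr)
  assume "\<not> card (nbrs E v) \<le> 2"
  then have "1 \<le> card (nbrs E v - {u, a})" using finite_nbrs[OF G] assms(2-4)
    by (simp add: insert_commute card_Diff_subset)
  then obtain b where b: "b \<in> nbrs E v - {u, a}"
    by (rule card_ge_1E)
  have "nbrs E u - {v, a, b} = nbrs E u - {v, b}" using assms(4) by auto
  moreover have "card (nbrs E u) - card {v, b} \<le> card (nbrs E u - {v, b})"
    by (intro diff_card_le_card_Diff) auto
  moreover have "card {v, b} \<le> 2" by (simp add: card_insert_if)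
  moreover have "card (nbrs E u - {v, a, b}) < n - 4"
    by (rule free_card_less) (use b assms in auto)
  ultimately show False using assms(1) by simp
qed

lemma card_outside_nbrs_le_1:
  assumes "n - 3 \<le> card (nbrs E u)" "{u, v} \<in> E"
  shows "card (nbrs E v - insert u (nbrs E u)) \<le> 1"
proof (rule ccontr)
  assume "\<not> card (nbrs E v - insert u (nbrs E u)) \<le> 1"
  then have "2 \<le> card (nbrs E v - insert u (nbrs E u))" by simp
  then obtain a b where ab: "a \<noteq> b" "{a, b} \<subseteq> nbrs E v - insert u (nbrs E u)"
    by (rule card_ge_2E)
  then have "nbrs E u - {v, a, b} = nbrs E u - {v}" by auto
  then have "card (nbrs E u - {v, a, b}) = card (nbrs E u) - 1"
    using assms(2) by simp
  moreover have "card (nbrs E u - {v, a, b}) < n - 4"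
    by (rule free_card_less) (use ab assms in auto)
  ultimately show False using assms(1) by simp
qed

text \<open>Any \<open>n - 1\<close> neighbours of \<open>u\<close> will do. Each has degree at most
  2 and so contributes at most 2 + 2 to the doubled count, which is within the average
  \<open>n - 2\<close> once \<open>n \<ge> 6\<close>. For \<open>n = 5\<close> this is too weak, and
  the neighbours are shown to have degree at most 1.\<close>

lemma light_if_degree_ge:
  assumes u: "n - 1 \<le> card (nbrs E u)"
  shows "\<exists>S. light V E n S"
proof -
  obtain S where S: "S \<subseteq> nbrs E u" "card S = n - 1"
    by (metis u obtain_subset_with_card_n)
  then have SV: "S \<subseteq> V" using nbrs_subset[OF G] by blast
  show ?thesis
  proof (cases "n = 5")
    case False
    have "card (nbrs E v) + card (nbrs E v - S) \<le> 4" if "v \<in> S" for v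
    proof -
      have "card (nbrs E v) \<le> 2" using nbr_degree_le_2[OF u] S(1) that by auto
      moreover have "card (nbrs E v - S) \<le> card (nbrs E v)"
        using finite_nbrs[OF G] by (simp add: card_mono)
      ultimately show ?thesis by simp
    qed
    then have "2 * card (incident E S) \<le> card S * 4"
      by (rule twice_card_incident_le[OF G SV])
    also have "\<dots> \<le> (n - 1) * (n - 2)" using S(2) False n by (simp add: mult_le_mono)
    finally show ?thesis using S(2) SV by (auto simp: light_def)
  next
    case True
    have deg: "card (nbrs E v) \<le> 1" if v: "v \<in> S" for v
    proof (rule ccontr)
      assume "\<not> card (nbrs E v) \<le> 1"
      moreover have uv: "{u, v} \<in> E" using v S(1) by auto
      ultimately have "1 \<le> card (nbrs E v - {u})"
        using finite_nbrs[OF G] by (simp add: insert_commute)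
      then obtain w where w: "w \<in> nbrs E v - {u}"
        by (rule card_ge_1E)
      have "card (nbrs E u) - card {v, w} \<le> card (nbrs E u - {v, w})"
        by (intro diff_card_le_card_Diff) auto
      moreover have "card {v, w} \<le> 2" by (simp add: card_insert_if)
      ultimately have "2 \<le> card (nbrs E u - {v, w})" using u True by simp
      then obtain a b where ab: "a \<noteq> b" "{a, b} \<subseteq> nbrs E u - {v, w}"
    by (rule card_ge_2E)
      \<comment> \<open>For \<open>n = 5\<close> the path \<open>w v u\<close> is a copy of \<open>v\<^sub>1 v\<^sub>0 v\<^sub>2\<close>, so \<open>v\<close> and not \<open>u\<close> plays the centre.\<close>
      have "card (nbrs E v - {u, a, b}) < n - 4"
        by (rule free_card_less) (use ab uv in \<open>auto simp: insert_commute\<close>)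
      moreover have "w \<in> nbrs E v - {u, a, b}" using w ab by auto
      ultimately show False using True finite_nbrs[OF G] by auto
    qed
    have "card (nbrs E v) + card (nbrs E v - S) \<le> 2" if "v \<in> S" for v
    proof -
      have "card (nbrs E v - S) \<le> card (nbrs E v)"
        using finite_nbrs[OF G] by (simp add: card_mono)
      then show ?thesis using deg[OF that] by simp
    qed
    then have "2 * card (incident E S) \<le> card S * 2"
      by (rule twice_card_incident_le[OF G SV])
    then show ?thesis using S(2) SV True by (auto simp: light_def)
  qed
qed

lemma closed_nbhd:
  assumes "u \<in> V"
  shows "insert u (nbrs E u) \<subseteq> V" "card (insert u (nbrs E u)) = card (nbrs E u) + 1"
  using assms nbrs_subset[OF G] finite_nbrs[OF G] G by auto

text \<open>The closed neighbourhood of \<open>u\<close> already has \<open>n - 1\<close> vertices,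
  so an average contribution of \<open>n - 2\<close> is allowed. A vertex with no neighbour outside
  contributes only its degree; any other has degree at most 2 and one outside neighbour, hence
  contributes at most 3.\<close>

lemma light_if_degree_eq:
  assumes uV: "u \<in> V" and u: "card (nbrs E u) = n - 2"
    and max: "\<And>v. card (nbrs E v) \<le> n - 2"
  shows "\<exists>S. light V E n S"
proof -
  let ?S = "insert u (nbrs E u)"
  have "card (nbrs E v) + card (nbrs E v - ?S) \<le> n - 2" if "v \<in> ?S" for v
  proof (cases "nbrs E v \<subseteq> ?S")
    case True
    then have "card (nbrs E v - ?S) = 0" by (metis Diff_eq_empty_iff card.empty)
    then show ?thesis using max[of v] by simp
  next
    case False
    then obtain a where a: "{v, a} \<in> E" "a \<notin> ?S" unfolding nbrs_def by blast
    then have "v \<noteq> u" by auto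
    then have uv: "{u, v} \<in> E" using that by auto
    have "card (nbrs E v) \<le> 2" using outside_nbr_degree_le_2[OF _ uv a] u by simp
    moreover have "card (nbrs E v - ?S) \<le> 1"
      using card_outside_nbrs_le_1[OF _ uv] u by simp
    ultimately show ?thesis using n by linarith
  qed
  then have "2 * card (incident E ?S) \<le> card ?S * (n - 2)"
    by (rule twice_card_incident_le[OF G closed_nbhd(1)[OF uV]])
  moreover have "card ?S = n - 1" using closed_nbhd(2)[OF uV] u n by simp
  ultimately show ?thesis unfolding light_def using closed_nbhd(1)[OF uV]
    by (intro exI[of _ ?S]) (simp only: simp_thms)
qed

text \<open>The closed neighbourhood of \<open>u\<close> has only \<open>n - 2\<close> vertices, so
  some \<open>w\<close> must be added. If every contribution is at most \<open>n - 3\<close>, the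
  slack pays for any \<open>w\<close> outside; otherwise \<open>w\<close> is chosen so that it
  brings at most one new edge.\<close>

lemma light_if_max_degree:
  assumes uV: "u \<in> V" and u: "card (nbrs E u) = n - 3"
    and max: "\<And>v. card (nbrs E v) \<le> n - 3" and V: "card V \<ge> n - 1"
  shows "\<exists>S. light V E n S"
proof -
  let ?S = "insert u (nbrs E u)"
  have SV: "?S \<subseteq> V" and cS: "card ?S = n - 2" using closed_nbhd[OF uV] u n by auto
  have out: "card (nbrs E v - ?S) \<le> 1" if "v \<in> ?S" for v
  proof (cases "v = u")
    case True
    then have "nbrs E v - ?S = {}" by auto
    then show ?thesis by (metis card.empty zero_le_one)
  next
    case False
    then show ?thesis using card_outside_nbrs_le_1[of u v] u that by simp
  qed
  have lightI: "light V E n (insert w ?S)"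
    if "w \<in> V - ?S" "2 * card (incident E ?S) + 2 * card (nbrs E w - ?S) \<le> (n - 1) * (n - 2)" for w
  proof -
    have "card (insert w ?S) = n - 1"
      using that(1) cS n finite_nbrs[OF G] by (subst card_insert_disjoint) auto
    then show ?thesis
      using that card_incident_insert_le[OF G, of w ?S] SV unfolding light_def
      by (intro conjI) (blast, assumption, linarith)
  qed
  show ?thesis
  proof (cases "\<forall>v\<in>?S. card (nbrs E v) + card (nbrs E v - ?S) \<le> n - 3")
    case True
    have "\<not> V \<subseteq> ?S"
    proof
      assume "V \<subseteq> ?S"
      then have "card V \<le> card ?S" using finite_nbrs[OF G] by (intro card_mono) auto
      then show False using cS V n by linarith
    qed
    then obtain w where w: "w \<in> V - ?S" by blast
    have "2 * card (incident E ?S) \<le> card ?S * (n - 3)"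
      by (rule twice_card_incident_le[OF G SV]) (use True in blast)
    moreover have "card (nbrs E w - ?S) \<le> n - 3"
      by (rule le_trans[OF card_mono[OF finite_nbrs[OF G] Diff_subset] max])
    ultimately have "2 * card (incident E ?S) + 2 * card (nbrs E w - ?S) \<le> (n - 2) * (n - 3) + 2 * (n - 3)"
      using cS by simp
    also have "\<dots> \<le> (n - 1) * (n - 2)"
    proof -
      \<comment> \<open>The substitution removes truncated subtraction. The left side is
        \<open>n * (n - 3)\<close>, smaller than the right by 2.\<close>
      obtain m where "n = m + 5" using n by (metis le_add_diff_inverse2)
      then show ?thesis by (simp add: algebra_simps)
    qed
    finally show ?thesis using lightI[OF w] by blast
  next
    case False
    \<comment> \<open>Some neighbour \<open>v\<close> of \<open>u\<close> has maximum degree and an outside neighbour \<open>w\<close>.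
      Then \<open>N[v]\<close> lies in \<open>N[u] \<union> {w}\<close>, so \<open>w\<close> has at most one neighbour beyond \<open>N[u]\<close>.\<close>
    then obtain v where v: "v \<in> ?S" "card (nbrs E v) + card (nbrs E v - ?S) > n - 3"
      unfolding not_le[symmetric] by blast
    then have "card (nbrs E v - ?S) = 1" and dv: "card (nbrs E v) = n - 3"
      using out[OF v(1)] max[of v] by linarith+
    then obtain w where w: "nbrs E v - ?S = {w}" by (metis card_1_singletonE)
    then have "w \<in> nbrs E v" and wS: "w \<notin> ?S" by blast+
    then have vw: "{v, w} \<in> E" by simp
    have wV: "w \<in> V" using nbrs_subset[OF G, of v] vw by auto
    have "w \<notin> nbrs E w" using G by simp
    have "nbrs E w - ?S \<subseteq> nbrs E w - insert v (nbrs E v)"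
    proof
      fix x assume x: "x \<in> nbrs E w - ?S"
      then have "x \<noteq> w" using \<open>w \<notin> nbrs E w\<close> by blast
      then show "x \<in> nbrs E w - insert v (nbrs E v)" using x w v(1) by blast
    qed
    then have "card (nbrs E w - ?S) \<le> card (nbrs E w - insert v (nbrs E v))"
      using finite_nbrs[OF G] by (simp add: card_mono)
    also have "\<dots> \<le> 1" using card_outside_nbrs_le_1[OF _ vw] dv by simp
    finally have 1: "card (nbrs E w - ?S) \<le> 1" .
    have "card (nbrs E x) + card (nbrs E x - ?S) \<le> n - 2" if "x \<in> ?S" for x
      using max[of x] out[OF that] n by linarith
    then have "2 * card (incident E ?S) \<le> card ?S * (n - 2)"
      by (rule twice_card_incident_le[OF G SV])
    then have "2 * card (incident E ?S) + 2 * card (nbrs E w - ?S) \<le> (n - 2) * (n - 2) + 2"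
      using 1 cS by simp
    also have "\<dots> \<le> (n - 1) * (n - 2)"
    proof -
      obtain m where "n = m + 5" using n by (metis le_add_diff_inverse2)
      then show ?thesis by (simp add: algebra_simps)
    qed
    finally show ?thesis using lightI wV wS by blast
  qed
qed

lemma light_exists:
  assumes V: "card V \<ge> n - 1" and u: "card (nbrs E u) \<ge> n - 3"
  shows "\<exists>S. light V E n S"
proof -
  \<comment> \<open>\<open>nbrs\<close> is defined for every element of the type; a nonzero degree
    places the element in \<open>V\<close>.\<close>
  have inV: "v \<in> V" if "card (nbrs E v) \<ge> n - 3" for v
  proof -
    have "1 \<le> card (nbrs E v)" using that n by linarith
    then obtain w where "w \<in> nbrs E v" by (rule card_ge_1E)
    then have "{v, w} \<in> E" by simp
    then show ?thesis using simple_graph_edgeD(2)[OF G, of "{v, w}"] by simp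
  qed
  have trichotomy: "d \<ge> n - 1 \<or> d = n - 2 \<or> d \<le> n - 3" for d using n by linarith
  consider v where "card (nbrs E v) \<ge> n - 1"
    | v where "card (nbrs E v) = n - 2" "\<forall>x. \<not> n - 1 \<le> card (nbrs E x)"
    | "\<forall>x. card (nbrs E x) \<le> n - 3"
    using trichotomy by metis
  then show ?thesis
  proof cases
    case 1 then show ?thesis by (rule light_if_degree_ge)
  next
    case 2
    have "card (nbrs E x) \<le> n - 2" for x
      using trichotomy[of "card (nbrs E x)"] spec[OF 2(2), of x] n by linarith
    moreover have "v \<in> V" by (rule inV) (use 2(1) n in linarith)
    ultimately show ?thesis using light_if_degree_eq 2 by blast
  next
    case 3
    have "card (nbrs E u) = n - 3" using u spec[OF 3, of u] by linarith
    then show ?thesis by (rule light_if_max_degree[OF inV[OF u] _ spec[OF 3] V])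
  qed
qed

end

section \<open>Induction on the number of vertices\<close>

lemma contains_mono:
  assumes "contains (V', E') H" "V' \<subseteq> V" "E' \<subseteq> E"
  shows "contains (V, E) H"
proof -
  obtain f where "inj_on f (fst H)" "f ` fst H \<subseteq> V'" "\<And>u v. {u, v} \<in> snd H \<Longrightarrow> {f u, f v} \<in> E'"
    using assms(1) by (auto simp: contains_def)
  then show ?thesis using assms(2,3) unfolding contains_def
    by (intro exI[of _ f]) auto
qed

lemma simple_graph_card_le:
  assumes G: "simple_graph V E"
  shows "2 * card E \<le> card V * (card V - 1)"
proof -
  have "card (nbrs E v) \<le> card V - 1" if "v \<in> V" for v
    using card_mono[OF _ nbrs_subset[OF G, of v]] simple_graph_finite(1)[OF G] that by simp
  then show ?thesis unfolding handshake[OF G]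
    using sum_bounded_above[of V "\<lambda>v. card (nbrs E v)" "card V - 1"] by simp
qed

text \<open>Edge counts are doubled and compared with \<open>(N - 1) * card V\<close>, so that the
  two candidate values become the deficits \<open>r * (N - r)\<close> and
  \<open>2 * (N + r)\<close>. Deleting a light set lowers the reference value by exactly
  \<open>N * (N - 1)\<close> and keeps \<open>r\<close>, so whichever alternative holds for the
  smaller graph is inherited.\<close>

lemma T2_free_card_le:
  fixes N :: nat
  assumes "simple_graph V E" "n \<ge> 5" "\<not> contains (V, E) (T2 n)"
  defines "N \<equiv> n - 1"
  defines "r \<equiv> card V mod N"
  shows "2 * card E + r * (N - r) \<le> (N - 1) * card V
    \<or> N \<le> card V \<and> 2 * card E + 2 * (N + r) \<le> (N - 1) * card V"
  using assms(1,3) unfolding r_def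
proof (induction "card V" arbitrary: V E rule: less_induct)
  case less
  note G = less.prems(1)
  have N: "n = N + 1" "N \<ge> 4" using assms(2) by (auto simp: N_def)
  show ?case
  proof (cases "card V < N")
    case True
    \<comment> \<open>Here \<open>r = card V\<close>, and the first alternative is the bound for the
      complete graph.\<close>
    obtain d where d: "N = card V + d + 1" using True
      by (metis add.assoc less_natE add.commute plus_1_eq_Suc)
    have "card V * (card V - 1) + card V * (N - card V) = (N - 1) * card V"
      unfolding d by (cases "card V") (simp_all add: algebra_simps)
    then show ?thesis using simple_graph_card_le[OF G] True by simp
  next
    case False
    then have V: "card V \<ge> N" by simp
    show ?thesis
    proof (cases "\<exists>u. card (nbrs E u) \<ge> n - 3")
      case True
      then obtain S where "light V E n S"
        using light_exists[OF G assms(2) less.prems(2)] V unfolding N_def by blast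
      then have S: "S \<subseteq> V" "card S = N" "2 * card (incident E S) \<le> N * (N - 1)"
        unfolding light_def N(1) by simp_all
      define E' where "E' = E - incident E S"
      have G': "simple_graph (V - S) E'"
        using simple_graph_edgeD[OF G] simple_graph_finite(1)[OF G]
        by (intro simple_graphI) (auto simp: E'_def incident_def)
      have free': "\<not> contains (V - S, E') (T2 n)"
        using less.prems(2) contains_mono[of "V - S" E' "T2 n" V E] by (auto simp: E'_def)
      have finS: "finite S" using S(1) simple_graph_finite(1)[OF G] finite_subset by blast
      have cV: "card V = card (V - S) + N"
        using card_Diff_subset[OF finS S(1)] S(2) V by simp
      have "card (V - S) < card V" using cV N by simp
      note IH = less.hyps[OF this G' free']
      have "incident E S \<subseteq> E" by (auto simp: incident_def)
      then have cE: "card E = card E' + card (incident E S)"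
        unfolding E'_def using simple_graph_finite(2)[OF G]
        by (metis card_Diff_subset card_mono finite_subset le_add_diff_inverse2)
      have r: "card V mod N = card (V - S) mod N" using cV by simp
      have "(N - 1) * card V = (N - 1) * card (V - S) + N * (N - 1)"
        unfolding cV by (simp add: algebra_simps)
      then show ?thesis unfolding r using IH cE S(3) V by linarith
    next
      case False
      have "card (nbrs E v) \<le> N - 3" for v
      proof -
        have "card (nbrs E v) < n - 3" using False not_le by blast
        then show ?thesis using N by linarith
      qed
      \<comment> \<open>Every degree is at least 2 below \<open>N - 1\<close>, a deficit of
        \<open>2 * card V\<close>. As \<open>card V \<ge> N\<close>, the quotient by
        \<open>N\<close> is at least 1, so \<open>card V \<ge> N + r\<close>.\<close>
      then have "2 * card E \<le> card V * (N - 3)"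
        unfolding handshake[OF G] using sum_bounded_above[of V "\<lambda>v. card (nbrs E v)" "N - 3"] by simp
      moreover have "N + card V mod N \<le> card V"
        using le_mod_geq[OF V] mod_less_eq_dividend[of "card V - N" N] V by linarith
      moreover have "card V * (N - 3) + 2 * card V = (N - 1) * card V"
      proof -
        obtain m where "N = m + 4" using N(2) by (metis le_add_diff_inverse2)
        then show ?thesis by (simp add: algebra_simps)
      qed
      ultimately have "2 * card E + 2 * (N + card V mod N) \<le> (N - 1) * card V"
        by (metis add_mono mult_le_mono2)
      then show ?thesis using V by simp
    qed
  qed
qed

section \<open>Extremal graphs\<close>

lemma simple_graph_insert_edge:
  assumes "simple_graph V E" "x \<in> V" "y \<in> V" "x \<noteq> y"
  shows "simple_graph V (insert {x, y} E)"
  using assms unfolding simple_graph_def by blast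

lemma nbrs_insert_edge:
  "nbrs (insert {x, y} E) v = nbrs E v \<union> (if v = x then {y} else {}) \<union> (if v = y then {x} else {})"
  by (auto simp: doubleton_eq_iff)

lemma nbrs_delete_edge:
  "nbrs (E - {{x, y}}) v = nbrs E v - (if v = x then {y} else {}) - (if v = y then {x} else {})"
  by (auto simp: doubleton_eq_iff)

text \<open>In a graph with the maximum number of edges among those of maximum degree at most \<open>D\<close>,
  the vertices of degree below \<open>D\<close> form a clique. If the total deficiency were two or more, an
  edge \<open>xy\<close> could be exchanged for \<open>ux\<close> and \<open>vy\<close>, where \<open>u\<close> and \<open>v\<close> (possibly equal)
  are deficient.\<close>

lemma near_regular_exists:
  fixes V :: "'a set"
  assumes fin: "finite V" and D: "D < card V"
  shows "\<exists>E. simple_graph V E \<and> (\<forall>v. card (nbrs E v) \<le> D) \<and> D * card V \<le> 2 * card E + 1"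
proof -
  define \<G> where "\<G> = {E. simple_graph V E \<and> (\<forall>v. card (nbrs E v) \<le> D)}"
  have "\<G> \<subseteq> Pow (Pow V)" using simple_graph_edgeD(2) unfolding \<G>_def by fastforce
  then have "finite \<G>" using fin by (meson finite_Pow_iff finite_subset)
  moreover have "{} \<in> \<G>" using fin by (simp add: \<G>_def simple_graph_def nbrs_def)
  ultimately have "Max (card ` \<G>) \<in> card ` \<G>" by (intro Max_in) auto
  then obtain E where E: "E \<in> \<G>" "card E = Max (card ` \<G>)" by (metis imageE)
  have max: "card E' \<le> card E" if "E' \<in> \<G>" for E'
    unfolding E(2) using that \<open>finite \<G>\<close> by (intro Max_ge) auto
  have G: "simple_graph V E" and deg: "card (nbrs E v) \<le> D" for v using E(1) by (auto simp: \<G>_def)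
  note finE = simple_graph_finite(2)[OF G] and finN = finite_nbrs[OF G]
  have clique: "{u, v} \<in> E"
    if "u \<in> V" "v \<in> V" "u \<noteq> v" "card (nbrs E u) < D" "card (nbrs E v) < D" for u v
  proof (rule ccontr)
    assume uv: "{u, v} \<notin> E"
    have "card (nbrs (insert {u, v} E) x) \<le> D" for x
      using that deg[of x] finN by (auto simp: nbrs_insert_edge card_insert_if)
    then have "insert {u, v} E \<in> \<G>"
      using simple_graph_insert_edge[OF G] that by (simp add: \<G>_def)
    then show False using max[of "insert {u, v} E"] uv finE by simp
  qed
  \<comment> \<open>When \<open>u = v\<close>, the exchange raises the degree of that single vertex
    by 2, hence the last condition.\<close>
  have exchange: False
    if uv: "u \<in> V" "v \<in> V" "card (nbrs E u) < D" "card (nbrs E v) < D"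
      "u = v \<Longrightarrow> card (nbrs E u) + 2 \<le> D" for u v
  proof -
    have adj: "u \<noteq> v \<Longrightarrow> {u, v} \<in> E" using clique uv by blast
    have "\<not> V \<subseteq> insert u (nbrs E u)"
    proof
      assume "V \<subseteq> insert u (nbrs E u)"
      then have "card V \<le> card (insert u (nbrs E u))" using finN by (intro card_mono) auto
      also have "\<dots> \<le> card (nbrs E u) + 1" using finN by (simp add: card_insert_if)
      finally show False using D uv(3) by linarith
    qed
    then obtain x where x: "x \<in> V" "x \<noteq> u" "{u, x} \<notin> E" unfolding nbrs_def by blast
    have xv: "x \<noteq> v" using adj x(2,3) by metis
    have "card (nbrs E x) = D"
    proof (rule ccontr)
      assume "card (nbrs E x) \<noteq> D"
      then have "card (nbrs E x) < D" using deg[of x] by simp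
      then show False using clique[OF uv(1) x(1) x(2)[symmetric] uv(3)] x(3) by simp
    qed
    \<comment> \<open>The vertex \<open>x\<close> has \<open>D\<close> neighbours and is not
      adjacent to \<open>u\<close>. Removing \<open>u\<close> from the closed neighbourhood of
      \<open>v\<close> leaves fewer than \<open>D\<close> vertices: either \<open>u = v\<close>, or
      \<open>u\<close> is a neighbour of \<open>v\<close> by \<open>clique\<close>. So some
      neighbour \<open>y\<close> of \<open>x\<close> is available for the new edge
      \<open>vy\<close>.\<close>
    have "\<not> nbrs E x \<subseteq> insert v (nbrs E v) - {u}"
    proof (rule notI)
      assume sub: "nbrs E x \<subseteq> insert v (nbrs E v) - {u}"
      have "card (insert v (nbrs E v) - {u}) < D"
      proof (cases "u = v")
        case True
        then have "insert v (nbrs E v) - {u} \<subseteq> nbrs E v" by auto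
        then have "card (insert v (nbrs E v) - {u}) \<le> card (nbrs E v)"
          by (rule card_mono[OF finN])
        then show ?thesis using uv(4) by simp
      next
        case False
        then have "u \<in> nbrs E v" using adj by (simp add: insert_commute)
        then have "card (insert v (nbrs E v) - {u}) = card (insert v (nbrs E v)) - 1" by simp
        also have "\<dots> \<le> card (nbrs E v)" using finN by (simp add: card_insert_if)
        finally show ?thesis using uv(4) by simp
      qed
      moreover have "finite (insert v (nbrs E v) - {u})" using finN[of v] by simp
      ultimately show False using card_mono[OF _ sub] \<open>card (nbrs E x) = D\<close> by simp
    qed
    moreover have "u \<notin> nbrs E x" using x(3) by (simp add: insert_commute)
    ultimately obtain y where "y \<in> nbrs E x" "y \<noteq> u" "y \<noteq> v" "y \<notin> nbrs E v" by blast
    then have y: "{x, y} \<in> E" "y \<noteq> u" "y \<noteq> v" "{v, y} \<notin> E" by simp_all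
    have yV: "y \<in> V" using simple_graph_edgeD(2)[OF G y(1)] by simp
    have xy: "x \<noteq> y" using edge_neq[OF G y(1)] .
    define E1 where "E1 = E - {{x, y}}"
    define E' where "E' = insert {u, x} (insert {v, y} E1)"
    have "simple_graph V E1" using G by (auto simp: E1_def simple_graph_def)
    then have "simple_graph V E'"
      unfolding E'_def using uv x y yV by (intro simple_graph_insert_edge) auto
    moreover have "card (nbrs E' z) \<le> D" for z
    proof -
      have N: "nbrs E' z = nbrs E z - (if z = x then {y} else {}) - (if z = y then {x} else {})
        \<union> (if z = v then {y} else {}) \<union> (if z = y then {v} else {})
        \<union> (if z = u then {x} else {}) \<union> (if z = x then {u} else {})"
        by (simp only: E'_def E1_def nbrs_insert_edge nbrs_delete_edge)
      have ins2: "card (insert a (insert b A)) \<le> card A + 2" "card (insert a A) \<le> card A + 1"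
        if "finite A" for a b :: 'a and A using that by (auto simp: card_insert_if)
      have swap: "card (insert b (A - {a})) \<le> card A" if "finite A" "a \<in> A" for a b :: 'a and A
        using ins2(2)[of "A - {a}" b] card.remove[OF that] that(1) by simp
      \<comment> \<open>\<open>x\<close> and \<open>y\<close> trade one neighbour for another, so
        only \<open>u\<close> and \<open>v\<close> can gain degree.\<close>
      consider "z = x" | "z = y" | "z = u" "z = v" | "z = u" "z \<noteq> v" | "z = v" "z \<noteq> u"
        | "z \<noteq> x" "z \<noteq> y" "z \<noteq> u" "z \<noteq> v" by blast
      then show ?thesis
      proof cases
        case 1
        then have "nbrs E' z = insert u (nbrs E x - {y})" unfolding N using x xv xy by auto
        then show ?thesis using swap[OF finN, of y x u] y(1) deg[of x] by simp
      next
        case 2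
        then have "nbrs E' z = insert v (nbrs E y - {x})" unfolding N using y xy by auto
        moreover have "x \<in> nbrs E y" using y(1) by (simp add: insert_commute)
        ultimately show ?thesis using swap[OF finN, of x y v] deg[of y] by simp
      next
        case 3
        then have "nbrs E' z = insert x (insert y (nbrs E u))" unfolding N using x y by auto
        then show ?thesis using ins2(1)[OF finN, of x y u] uv(5) 3 by simp
      next
        case 4
        then have "nbrs E' z = insert x (nbrs E u)" unfolding N using x y by auto
        then show ?thesis using ins2(2)[OF finN, of x u] uv(3) by simp
      next
        case 5
        then have "nbrs E' z = insert y (nbrs E v)" unfolding N using x y xv by auto
        then show ?thesis using ins2(2)[OF finN, of y v] uv(4) by simp
      next
        case 6
        then have "nbrs E' z = nbrs E z" unfolding N by auto
        then show ?thesis using deg by simp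
      qed
    qed
    ultimately have "card E' \<le> card E" using max by (simp add: \<G>_def)
    moreover have "card E' = card E + 1"
    proof -
      have "{v, y} \<notin> E1" "{u, x} \<notin> insert {v, y} E1"
        using x y xv xy by (auto simp: E1_def doubleton_eq_iff)
      moreover have "card E1 + 1 = card E" using card_Suc_Diff1[OF finE y(1)] by (simp add: E1_def)
      moreover have "finite E1" using finE by (simp add: E1_def)
      ultimately show ?thesis by (simp add: E'_def)
    qed
    ultimately show False by simp
  qed
  have "D * card V = (\<Sum>v\<in>V. card (nbrs E v)) + (\<Sum>v\<in>V. D - card (nbrs E v))"
    using deg by (simp flip: sum.distrib)
  moreover have "(\<Sum>v\<in>V. D - card (nbrs E v)) \<le> 1"
  proof (cases "\<exists>u\<in>V. card (nbrs E u) < D")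
    case True
    then obtain u where u: "u \<in> V" "card (nbrs E u) < D" by blast
    have "card (nbrs E v) = D" if "v \<in> V - {u}" for v
    proof (rule ccontr)
      assume "card (nbrs E v) \<noteq> D"
      then have "card (nbrs E v) < D" using deg[of v] by simp
      moreover have "v \<in> V" "u \<noteq> v" using that by auto
      ultimately show False using exchange[of u v] u by blast
    qed
    then have "(\<Sum>v\<in>V - {u}. D - card (nbrs E v)) = 0" by simp
    then have "(\<Sum>v\<in>V. D - card (nbrs E v)) = D - card (nbrs E u)"
      using sum.remove[OF fin u(1), of "\<lambda>v. D - card (nbrs E v)"] by simp
    moreover have "\<not> card (nbrs E u) + 2 \<le> D" using exchange[of u u] u by blast
    ultimately show ?thesis by linarith
  next
    case False
    then have "(\<Sum>v\<in>V. D - card (nbrs E v)) = 0" by (intro sum.neutral) (simp add: not_less)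
    then show ?thesis by linarith
  qed
  ultimately show ?thesis using G deg handshake[OF G] by (intro exI[of _ E]) simp
qed

section \<open>Graphs that avoid the tree\<close>

lemma contains_T2E:
  assumes "contains (V, E) (T2 n)"
  obtains f where "inj_on f {0..<n}" "f ` {0..<n} \<subseteq> V"
    "\<And>u v. {u, v} \<in> snd (T2 n) \<Longrightarrow> {f u, f v} \<in> E"
proof -
  have "fst (T2 n) = {0..<n}" by (simp add: T2_def)
  then show thesis using assms that unfolding contains_def by (metis fst_conv snd_conv)
qed

lemma not_contains_T2_small:
  assumes "finite V" "card V < n"
  shows "\<not> contains (V, E) (T2 n)"
proof
  assume "contains (V, E) (T2 n)"
  then obtain f where "inj_on f {0..<n}" "f ` {0..<n} \<subseteq> V"
    by (rule contains_T2E)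
  then show False using card_inj_on_le[of f "{0..<n}" V] assms by simp
qed

text \<open>The image of the centre \<open>0\<close> would need \<open>n - 3\<close>
  neighbours.\<close>

lemma not_contains_T2_max_degree:
  assumes G: "simple_graph V E" and n: "n \<ge> 5" and deg: "\<And>v. card (nbrs E v) \<le> n - 4"
  shows "\<not> contains (V, E) (T2 n)"
proof
  assume "contains (V, E) (T2 n)"
  then obtain f where f: "inj_on f {0..<n}" "f ` {0..<n} \<subseteq> V"
    "\<And>u v. {u, v} \<in> snd (T2 n) \<Longrightarrow> {f u, f v} \<in> E"
    by (rule contains_T2E) blast
  have "{0, i} \<in> snd (T2 n)" if "i \<in> {1..n - 3}" for i using that by (auto simp: T2_def)
  then have "f ` {1..n - 3} \<subseteq> nbrs E (f 0)" using f(3) by auto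
  moreover have "inj_on f {1..n - 3}" by (rule inj_on_subset[OF f(1)]) (use n in auto)
  ultimately have "card {1..n - 3} \<le> card (nbrs E (f 0))"
    using finite_nbrs[OF G] card_inj_on_le by blast
  then show False using deg[of "f 0"] n by simp
qed

text \<open>No edge joins \<open>V\<close> to \<open>A\<close>, and the tree is connected, so a copy
  lies entirely on one side. In \<open>A\<close> there are too few vertices, and in \<open>V\<close>
  the copy would use edges of \<open>E\<close> only.\<close>

lemma T2_free_Un_complete:
  assumes n: "n \<ge> 5" and G: "simple_graph V E" and free: "\<not> contains (V, E) (T2 n)"
    and A: "finite A" "card A < n" "V \<inter> A = {}"
  defines "K \<equiv> {e. e \<subseteq> A \<and> card e = 2}"
  shows "simple_graph (V \<union> A) (E \<union> K)" "\<not> contains (V \<union> A, E \<union> K) (T2 n)"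
    "card (E \<union> K) = card E + (card A choose 2)"
proof -
  note edge = simple_graph_edgeD[OF G] and fin = simple_graph_finite[OF G]
  show "simple_graph (V \<union> A) (E \<union> K)"
    using edge fin A by (intro simple_graphI) (auto simp: K_def)
  have disj: "e \<inter> A = {} \<and> e \<noteq> {}" if "e \<in> E" for e using edge[OF that] A(3) by fastforce
  have "E \<inter> K = {}" using disj by (fastforce simp: K_def)
  moreover have "finite K" using A(1) by (simp add: K_def)
  ultimately show "card (E \<union> K) = card E + (card A choose 2)"
    using fin n_subsets[OF A(1), of 2] by (simp add: card_Un_disjoint K_def)
  show "\<not> contains (V \<union> A, E \<union> K) (T2 n)"
  proof
    assume "contains (V \<union> A, E \<union> K) (T2 n)"
    then obtain f where f: "inj_on f {0..<n}" "f ` {0..<n} \<subseteq> V \<union> A"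
      "\<And>u v. {u, v} \<in> snd (T2 n) \<Longrightarrow> {f u, f v} \<in> E \<union> K"
      by (rule contains_T2E) blast
    have same: "f u \<in> A \<longleftrightarrow> f v \<in> A" if "{u, v} \<in> snd (T2 n)" for u v
      using f(3)[OF that] disj[of "{f u, f v}"] by (auto simp: K_def)
    have i0: "f i \<in> A \<longleftrightarrow> f 0 \<in> A" if "i \<in> {1..n - 3}" for i
      using same[of 0 i] that by (auto simp: T2_def)
    have "f i \<in> A \<longleftrightarrow> f 0 \<in> A" if i: "i < n" for i
    proof -
      have "f (n - 2) \<in> A \<longleftrightarrow> f (n - 3) \<in> A" "f (n - 1) \<in> A \<longleftrightarrow> f (n - 3) \<in> A"
        using same[of "n - 3" "n - 2"] same[of "n - 3" "n - 1"] by (auto simp: T2_def)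
      moreover have "f (n - 3) \<in> A \<longleftrightarrow> f 0 \<in> A" using i0[of "n - 3"] n by simp
      moreover have "i = 0 \<or> i \<in> {1..n - 3} \<or> i = n - 2 \<or> i = n - 1" using i by auto
      ultimately show ?thesis using i0 by metis
    qed note conn = this
    show False
    proof (cases "f 0 \<in> A")
      case True
      then have "f ` {0..<n} \<subseteq> A" using conn by auto
      then show False using card_inj_on_le[OF f(1) _ A(1)] A(2) by simp
    next
      case False
      then have "f i \<notin> A" if "i < n" for i using conn that by blast
      then have "f ` {0..<n} \<subseteq> V" using f(2) by fastforce
      moreover have "{f u, f v} \<in> E" if uv: "{u, v} \<in> snd (T2 n)" for u v
      proof -
        have "\<forall>e \<in> snd (T2 n). e \<subseteq> {0..<n}" using n by (auto simp: T2_def)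
        then have "{u, v} \<subseteq> {0..<n}" using uv by blast
        then have "f u \<notin> A" using conn False by auto
        then show ?thesis using f(3)[OF uv] by (auto simp: K_def)
      qed
      ultimately have "contains (V, E) (T2 n)"
        using f(1) unfolding contains_def by (intro exI[of _ f]) (simp add: T2_def)
      then show False using free by simp
    qed
  qed
qed

lemma twice_choose_two: "2 * (m choose 2) = m * (m - 1)"
  by (cases m) (simp_all add: choose_two dvd_mult_div_cancel del: mult_Suc mult_Suc_right)

text \<open>Both lower-bound constructions have this shape and differ only in the base graph
  \<open>E0\<close>. Each new complete component occupies the next block of \<open>N\<close>
  integers.\<close>

lemma T2_free_add_complete_components:
  fixes N :: nat
  assumes n: "n \<ge> 5"
    and base: "simple_graph {0..<q} E0" "\<not> contains ({0..<q}, E0) (T2 n)"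
  defines "N \<equiv> n - 1"
  shows "\<exists>E. simple_graph {0..<q + k * N} E \<and> \<not> contains ({0..<q + k * N}, E) (T2 n)
    \<and> 2 * card E = 2 * card E0 + k * (N * (N - 1))"
proof (induction k)
  case 0
  show ?case using base by auto
next
  case (Suc k)
  then obtain E where E: "simple_graph {0..<q + k * N} E" "\<not> contains ({0..<q + k * N}, E) (T2 n)"
    "2 * card E = 2 * card E0 + k * (N * (N - 1))" by blast
  let ?A = "{q + k * N..<q + Suc k * N}"
  let ?E = "E \<union> {e. e \<subseteq> ?A \<and> card e = 2}"
  have A: "card ?A = N" by simp
  then have "card ?A < n" using n by (simp add: N_def)
  note un = T2_free_Un_complete[OF n E(1,2) _ this]
  have "{0..<q + k * N} \<union> ?A = {0..<q + Suc k * N}" by auto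
  then have "simple_graph {0..<q + Suc k * N} ?E"
    "\<not> contains ({0..<q + Suc k * N}, ?E) (T2 n)" "card ?E = card E + (N choose 2)"
    using un unfolding A by auto
  moreover have "2 * (card E + (N choose 2)) = 2 * card E0 + Suc k * (N * (N - 1))"
    using E(3) twice_choose_two[of N] by simp
  ultimately show ?case by (intro exI[of _ ?E]) simp
qed

section \<open>Bounds on the extremal number\<close>

lemma finite_extremal_family:
  fixes p :: nat
  shows "finite {card E | E. simple_graph {0..<p} E \<and> \<not> contains ({0..<p}, E) L}"
proof -
  have "{E. simple_graph {0..<p} E \<and> \<not> contains ({0..<p}, E) L} \<subseteq> Pow (Pow {0..<p})"
    using simple_graph_edgeD(2) by fast
  then have "finite {E. simple_graph {0..<p} E \<and> \<not> contains ({0..<p}, E) L}"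
    by (rule finite_subset) simp
  then show ?thesis by simp
qed

lemma card_le_ex:
  assumes "simple_graph {0..<p} E" "\<not> contains ({0..<p}, E) L"
  shows "card E \<le> ex p L"
  unfolding ex_def using assms by (intro Max_ge finite_extremal_family) blast

text \<open>The given graph shows that the family is nonempty, without which \<open>Max\<close> need
  not be attained.\<close>

lemma ex_attained:
  assumes "simple_graph {0..<p} E" "\<not> contains ({0..<p}, E) L"
  obtains E' where "simple_graph {0..<p} E'" "\<not> contains ({0..<p}, E') L" "card E' = ex p L"
proof -
  have "ex p L \<in> {card E | E. simple_graph {0..<p} E \<and> \<not> contains ({0..<p}, E) L}"
    unfolding ex_def using assms by (intro Max_in finite_extremal_family) blast
  then show thesis using that by auto
qed

text \<open>The first two bounds come from the two constructions, the third from the induction. The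
  1 in the second is the parity loss of a near-regular graph.\<close>

lemma ex_T2_bounds:
  fixes n p N :: nat
  assumes n: "n \<ge> 5" and p: "p \<ge> n - 1"
  defines "N \<equiv> n - 1"
  defines "r \<equiv> p mod N"
  shows "(N - 1) * p \<le> 2 * ex p (T2 n) + r * (N - r)"
    and "(N - 1) * p \<le> 2 * ex p (T2 n) + 2 * (N + r) + 1"
    and "2 * ex p (T2 n) + r * (N - r) \<le> (N - 1) * p \<or> 2 * ex p (T2 n) + 2 * (N + r) \<le> (N - 1) * p"
proof -
  have N: "N \<ge> 4" using n by (simp add: N_def)
  have rN: "r < N" using N by (simp add: r_def)
  \<comment> \<open>Here \<open>k\<close> is one less than the quotient of \<open>p\<close> by
    \<open>N\<close>: one block is held back so that \<open>N + r\<close> vertices remain for the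
    near-regular graph. The construction with a complete graph on \<open>r\<close> vertices uses
    \<open>Suc k\<close> blocks.\<close>
  obtain k where pk: "p = (N + r) + k * N"
  proof -
    have "p div N \<ge> 1" using p N unfolding N_def[symmetric] by (simp add: div_greater_zero_iff Suc_le_eq)
    then obtain k where "p div N = Suc k" by (cases "p div N") auto
    then have "p = Suc k * N + r" unfolding r_def by (metis div_mult_mod_eq)
    then show thesis using that[of k] by simp
  qed
  obtain s where s: "N = r + s" using rN less_imp_le_nat nat_le_iff_add by blast
  obtain m where m: "N = m + 4" using N by (metis le_add_diff_inverse2)
  let ?K = "{e. e \<subseteq> {0..<r} \<and> card e = 2}"
  have K: "simple_graph {0..<r} ?K" by (rule simple_graphI) auto
  have Kfree: "\<not> contains ({0..<r}, ?K) (T2 n)"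
    by (rule not_contains_T2_small) (use rN in \<open>auto simp: N_def\<close>)
  have Kcard: "2 * card ?K = r * (r - 1)"
    using n_subsets[of "{0..<r}" 2] twice_choose_two[of r] by simp
  obtain E where E: "simple_graph {0..<r + Suc k * N} E"
    "\<not> contains ({0..<r + Suc k * N}, E) (T2 n)" "2 * card E = 2 * card ?K + Suc k * (N * (N - 1))"
    using T2_free_add_complete_components[OF n K Kfree] unfolding N_def by blast
  have p': "r + Suc k * N = p" using pk by simp
  have "(N - 1) * p = 2 * card E + r * (N - r)"
  proof -
    have "r * (r - 1) + r * s = (N - 1) * r" unfolding s
      by (cases r) (simp_all add: algebra_simps)
    moreover have "t * (r + q * N) = t * r + q * (N * t)" for t q by (simp add: algebra_simps)
    ultimately have "(N - 1) * (r + Suc k * N) = r * (r - 1) + r * s + Suc k * (N * (N - 1))"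
      by (simp only:)
    then show ?thesis unfolding E(3) Kcard p'[symmetric] using s by (simp only: diff_add_inverse ac_simps)
  qed
  then show "(N - 1) * p \<le> 2 * ex p (T2 n) + r * (N - r)"
    using card_le_ex[OF E(1,2)] unfolding p' by simp
  \<comment> \<open>\<open>N - 3\<close> is \<open>n - 4\<close>, the largest maximum degree that
    excludes the tree by itself; it falls 2 short of \<open>N - 1\<close> at each of
    \<open>N + r\<close> vertices.\<close>
  obtain F0 where F0: "simple_graph {0..<N + r} F0" "\<And>v. card (nbrs F0 v) \<le> N - 3"
    "(N - 3) * (N + r) \<le> 2 * card F0 + 1"
  proof -
    have "N - 3 < card {0..<N + r}" using N by simp
    from near_regular_exists[OF _ this] show thesis using that by auto
  qed
  have "\<not> contains ({0..<N + r}, F0) (T2 n)"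
    by (rule not_contains_T2_max_degree[OF F0(1) n]) (use F0(2) N_def in simp)
  then obtain F where F: "simple_graph {0..<p} F" "\<not> contains ({0..<p}, F) (T2 n)"
    "2 * card F = 2 * card F0 + k * (N * (N - 1))"
    using T2_free_add_complete_components[OF n F0(1), of k] unfolding N_def[symmetric] pk by blast
  have "(N - 1) * p = (N - 3) * (N + r) + k * (N * (N - 1)) + 2 * (N + r)"
    unfolding pk m by (simp add: algebra_simps)
  then show "(N - 1) * p \<le> 2 * ex p (T2 n) + 2 * (N + r) + 1"
    using card_le_ex[OF F(1,2)] F(3) F0(3) by linarith
  obtain G where G: "simple_graph {0..<p} G" "\<not> contains ({0..<p}, G) (T2 n)" "card G = ex p (T2 n)"
    using ex_attained[OF F(1,2)] by blast
  show "2 * ex p (T2 n) + r * (N - r) \<le> (N - 1) * p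
      \<or> 2 * ex p (T2 n) + 2 * (N + r) \<le> (N - 1) * p"
    using T2_free_card_le[OF G(1) n G(2)] G(3) unfolding N_def r_def by auto
qed

section \<open>Comparing the two values\<close>

text \<open>The first claim rests on two factorisations: \<open>r * (N - r) - 2 * (N + r)\<close>
  equals \<open>(r - 3) * (N - 5 - r) + (N - 15)\<close> and also
  \<open>(r - 4) * (N - 6 - r) + (2 * N - 24)\<close>. Integers are used so that the differences are
  signed.\<close>

lemma deficit_comparison:
  fixes N r :: int
  assumes "4 \<le> N" "0 \<le> r" "r < N"
  shows "N \<ge> 15 \<and> 3 \<le> r \<and> r \<le> N - 5 \<or> 12 \<le> N \<and> N \<le> 14 \<and> 4 \<le> r \<and> r \<le> N - 6
      \<Longrightarrow> 2 * (N + r) \<le> r * (N - r)"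
    and "\<not> (N \<ge> 15 \<and> 3 \<le> r \<and> r \<le> N - 5 \<or> 12 \<le> N \<and> N \<le> 14 \<and> 4 \<le> r \<and> r \<le> N - 6)
      \<Longrightarrow> r * (N - r) \<le> 2 * (N + r)"
proof -
  assume "N \<ge> 15 \<and> 3 \<le> r \<and> r \<le> N - 5 \<or> 12 \<le> N \<and> N \<le> 14 \<and> 4 \<le> r \<and> r \<le> N - 6"
  then show "2 * (N + r) \<le> r * (N - r)"
  proof
    assume *: "N \<ge> 15 \<and> 3 \<le> r \<and> r \<le> N - 5"
    then have "0 \<le> (r - 3) * (N - 5 - r)" by simp
    then show ?thesis using * by (simp add: algebra_simps)
  next
    assume *: "12 \<le> N \<and> N \<le> 14 \<and> 4 \<le> r \<and> r \<le> N - 6"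
    then have "0 \<le> (r - 4) * (N - 6 - r)" by simp
    then show ?thesis using * by (simp add: algebra_simps)
  qed
next
  assume *: "\<not> (N \<ge> 15 \<and> 3 \<le> r \<and> r \<le> N - 5 \<or> 12 \<le> N \<and> N \<le> 14 \<and> 4 \<le> r \<and> r \<le> N - 6)"
  consider "N \<le> 11" | "r \<le> 2" | "r \<ge> N - 4" | "N \<le> 15" "r = 3 \<or> r = N - 5"
    using * by linarith
  then show "r * (N - r) \<le> 2 * (N + r)"
  proof cases
    case 1
    \<comment> \<open>Completing the square in \<open>r\<close>: four times the difference of the
      two sides is \<open>(2 * r - N + 2)^2 + (N - 1) * (11 - N) + 7\<close>.\<close>
    then have "0 \<le> (N - 1) * (11 - N)" using assms by simp
    moreover have "0 \<le> (2 * r - N + 2) * (2 * r - N + 2)" by simp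
    ultimately show ?thesis by (simp add: algebra_simps)
  next
    case 2
    then have "r * (N - r) \<le> 2 * (N - r)" using assms by (intro mult_right_mono) auto
    then show ?thesis using assms by simp
  next
    case 3
    then have "r * (N - r) \<le> r * 4" using assms by (intro mult_left_mono) auto
    then show ?thesis using assms by simp
  next
    case 4
    then show ?thesis by (auto simp: algebra_simps)
  qed
qed

theorem theorem3p1:
  fixes p n :: nat
  assumes "n - 1 \<ge> 4" and "p \<ge> n - 1"
  defines "r \<equiv> p mod (n - 1)"
  shows "real (ex p (T2 n)) =
           max (of_int \<lfloor>real ((n - 2) * p) / 2\<rfloor> - real (n - 1 + r))
               ((real ((n - 2) * p) - real r * (real n - 1 - real r)) / 2)
       \<and> real (ex p (T2 n)) =
           (if (n \<ge> 16 \<and> 3 \<le> r \<and> r \<le> n - 6) \<or> (13 \<le> n \<and> n \<le> 15 \<and> 4 \<le> r \<and> r \<le> n - 7)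
            then of_int \<lfloor>real ((n - 2) * p) / 2\<rfloor> - real (n - 1 + r)
            else (real ((n - 2) * p) - real r * (real n - 1 - real r)) / 2)"
proof -
  define N where "N = n - 1"
  define X where "X = (n - 2) * p"
  define C where "C = r * (N - r)"
  define M where "M = ex p (T2 n)"
  have n: "n \<ge> 5" "n = N + 1" "N \<ge> 4" using assms(1) by (auto simp: N_def)
  have rN: "r < N" using n(3) unfolding r_def N_def by simp
  have X: "X = (N - 1) * p" using n by (simp add: X_def)
  have B: "X \<le> 2 * M + C" "X \<le> 2 * M + 2 * (N + r) + 1" "2 * M + C \<le> X \<or> 2 * M + 2 * (N + r) \<le> X"
    using ex_T2_bounds[OF n(1) assms(2)] unfolding X C_def M_def r_def N_def by blast+
  define H where "H = X div 2"
  have half: "2 * H \<le> X" "X \<le> 2 * H + 1" by (simp_all add: H_def)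
  have fl: "of_int \<lfloor>real X / 2\<rfloor> = real H"
    unfolding H_def using floor_divide_of_nat_eq[of X 2, where 'a = real] by simp
  have realC: "real r * (real n - 1 - real r) = real C"
    using rN n(2) by (simp add: C_def of_nat_diff)
  have intC: "int r * (int N - int r) = int C"
    using rN by (simp add: C_def of_nat_diff)
  let ?cond = "(n \<ge> 16 \<and> 3 \<le> r \<and> r \<le> n - 6) \<or> (13 \<le> n \<and> n \<le> 15 \<and> 4 \<le> r \<and> r \<le> n - 7)"
  \<comment> \<open>The lower bound on \<open>n\<close> in each clause keeps \<open>n - 6\<close>
    and \<open>n - 7\<close> from truncating, so the passage to integers is exact.\<close>
  have cond: "?cond \<longleftrightarrow> int N \<ge> 15 \<and> 3 \<le> int r \<and> int r \<le> int N - 5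
      \<or> 12 \<le> int N \<and> int N \<le> 14 \<and> 4 \<le> int r \<and> int r \<le> int N - 6"
    using n(2) by auto
  note cmp = deficit_comparison[of "int N" "int r", unfolded intC, folded cond]
  have first: "real M = max (real (H) - real (N + r)) ((real X - real C) / 2)"
  proof -
    have "M + N + r \<ge> H" using B(2) half by arith
    \<comment> \<open>In the second alternative \<open>2 * (M + N + r)\<close> lies between
      \<open>X - 1\<close> and \<open>X\<close>, which forces \<open>M + N + r\<close> to be the
      rounded-down half of \<open>X\<close>. This is where the floor in the formula arises.\<close>
    moreover have "M + N + r = H \<or> 2 * M + C = X" using B(3)
    proof
      assume "2 * M + C \<le> X" then show ?thesis using B(1) by simp
    next
      assume "2 * M + 2 * (N + r) \<le> X" then show ?thesis using B(2) half by arith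
    qed
    moreover have "X \<le> 2 * M + C" by (rule B)
    ultimately show ?thesis by (auto simp: max_def)
  qed
  have second: "real M = (if ?cond then real (H) - real (N + r) else (real X - real C) / 2)"
  proof (cases ?cond)
    case True
    then have "2 * (N + r) \<le> C" using cmp(1) n rN by simp
    then have "2 * M + 2 * (N + r) \<le> X" using B(3) by linarith
    then have "M + N + r = H" using B(2) half by arith
    then show ?thesis using True by auto
  next
    case False
    then have "C \<le> 2 * (N + r)" using cmp(2) n rN by simp
    then have "2 * M + C \<le> X" using B(3) by linarith
    then have "2 * M + C = X" using B(1) by simp
    then have "real M = (real X - real C) / 2" by auto
    then show ?thesis using False by (simp only: if_False)
  qed
  show ?thesis
    using first second unfolding realC fl[unfolded X_def] X_def M_def N_def by blast
qed

end
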